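(* Let $\mathcal{E}_1: 0\to I\to E\xrightarrow{\pi_1}H\to0$ be an extension of skew left braces, for some fixed skew left brace structures on $I$, $E$ and $H$, such that the additive groups of $I$, $E$ and $H$ are complete groups. Then there exist Rota-Baxter operators $R_I,R_E,R_H$ on (the additive groups of) $I$, $E$, $H$, respectively, such that $\mathcal{E}_2: 0\to(I,R_I)\to(E,R_E)\xrightarrow{\pi_1}(H,R_H)\to0$ is an extension of Rota-Baxter groups and the skew brace extension defined by $\mathcal{E}_2$ is the same as $\mathcal{E}_1$.
   Context: A skew left brace is a triple $(E,+,\circ)$ with $(E,+)$ and $(E,\circ)$ groups (not necessarily abelian) such that $a\circ(b+c)=a\circ b-a+a\circ c$ for all $a,b,c$; $(E,+)$ is its additive group. Morphisms preserve both operations. An extension of skew left braces $0\to I\to E\to H\to 0$ is a short exact sequence of skew left brace morphisms (the first injective, the second surjective, with image of the first equal to the kernel of the second). A group is complete if its center is trivial and all its automorphisms are inner. A Rota-Baxter operator (of weight 1) on a group $(G,\cdot)$ is a map $R_G:G\to G$ with $R_G(x)R_G(y)=R_G(xR_G(x)yR_G(x)^{-1})$ for all $x,y$; $(G,R_G)$ is a Rota-Baxter group. Morphisms are group homomorphisms commuting with the operators. A Rota-Baxter group induces a skew left brace $(G,\cdot,\circ_{R_G})$ with additive group $(G,\cdot)$ and $x\circ_{R_G}y=xR_G(x)yR_G(x)^{-1}$. An extension of Rota-Baxter groups is a short exact sequence of groups whose maps are morphisms of Rota-Baxter groups; it induces an extension of the induced skew left braces. *)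

theory Defs
  imports "HOL-Algebra.AbelCoset" "HOL-Algebra.Bij"
begin

text \<open>
  A skew left brace is carried by the library record \<open>ring\<close>, used only as a signature for two
  operations on one carrier: \<open>\<oplus>\<close> (with \<open>\<zero>\<close>) is the possibly non-commutative
  operation $+$, and \<open>\<otimes>\<close> (with \<open>\<one>\<close>) is $\circ$. The operations \<open>\<ominus>\<close> of the
  library are defined from the monoid \<open>add_monoid\<close> alone, so they do not presuppose
  commutativity; \<open>x \<ominus> y\<close> is $x + (-y)$.
\<close>

definition skew_left_brace :: "'a ring \<Rightarrow> bool" where
  "skew_left_brace E \<longleftrightarrow>
     group (add_monoid E) \<and> group E \<and>
     (\<forall>a\<in>carrier E. \<forall>b\<in>carrier E. \<forall>c\<in>carrier E.
        a \<otimes>\<^bsub>E\<^esub> (b \<oplus>\<^bsub>E\<^esub> c) = (a \<otimes>\<^bsub>E\<^esub> b \<ominus>\<^bsub>E\<^esub> a) \<oplus>\<^bsub>E\<^esub> (a \<otimes>\<^bsub>E\<^esub> c))"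

definition skew_brace_hom :: "'a ring \<Rightarrow> 'b ring \<Rightarrow> ('a \<Rightarrow> 'b) set" where
  "skew_brace_hom E F = hom (add_monoid E) (add_monoid F) \<inter> hom E F"

text \<open>
  The library's \<open>short_exact_sequence\<close> requires all groups to share one element type, so
  exactness is spelled out here. The kernel of a skew brace morphism is its additive kernel.
\<close>

definition skew_brace_extension ::
    "'a ring \<Rightarrow> 'b ring \<Rightarrow> 'c ring \<Rightarrow> ('a \<Rightarrow> 'b) \<Rightarrow> ('b \<Rightarrow> 'c) \<Rightarrow> bool" where
  "skew_brace_extension I E H i p \<longleftrightarrow>
     skew_left_brace I \<and> skew_left_brace E \<and> skew_left_brace H \<and>
     i \<in> skew_brace_hom I E \<and> p \<in> skew_brace_hom E H \<and>
     inj_on i (carrier I) \<and> p ` carrier E = carrier H \<and>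
     i ` carrier I = a_kernel E H p"

text \<open>Equality of skew brace structures, disregarding junk values outside the carrier.\<close>

definition skew_brace_eq :: "'a ring \<Rightarrow> 'a ring \<Rightarrow> bool" where
  "skew_brace_eq E F \<longleftrightarrow>
     carrier E = carrier F \<and> \<zero>\<^bsub>E\<^esub> = \<zero>\<^bsub>F\<^esub> \<and> \<one>\<^bsub>E\<^esub> = \<one>\<^bsub>F\<^esub> \<and>
     (\<forall>x\<in>carrier E. \<forall>y\<in>carrier E.
        x \<oplus>\<^bsub>E\<^esub> y = x \<oplus>\<^bsub>F\<^esub> y \<and> x \<otimes>\<^bsub>E\<^esub> y = x \<otimes>\<^bsub>F\<^esub> y)"

definition group_center :: "('a, 'm) monoid_scheme \<Rightarrow> 'a set" where
  "group_center G = {z \<in> carrier G. \<forall>x\<in>carrier G. z \<otimes>\<^bsub>G\<^esub> x = x \<otimes>\<^bsub>G\<^esub> z}"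

definition inner_automorphism :: "('a, 'm) monoid_scheme \<Rightarrow> ('a \<Rightarrow> 'a) \<Rightarrow> bool" where
  "inner_automorphism G f \<longleftrightarrow>
     (\<exists>g\<in>carrier G. \<forall>x\<in>carrier G. f x = g \<otimes>\<^bsub>G\<^esub> x \<otimes>\<^bsub>G\<^esub> inv\<^bsub>G\<^esub> g)"

definition complete_group :: "('a, 'm) monoid_scheme \<Rightarrow> bool" where
  "complete_group G \<longleftrightarrow>
     group G \<and> group_center G = {\<one>\<^bsub>G\<^esub>} \<and> (\<forall>f\<in>auto G. inner_automorphism G f)"

definition rota_baxter_operator :: "('a, 'm) monoid_scheme \<Rightarrow> ('a \<Rightarrow> 'a) \<Rightarrow> bool" where
  "rota_baxter_operator G R \<longleftrightarrow>
     R \<in> carrier G \<rightarrow> carrier G \<and>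
     (\<forall>x\<in>carrier G. \<forall>y\<in>carrier G.
        R x \<otimes>\<^bsub>G\<^esub> R y = R (x \<otimes>\<^bsub>G\<^esub> R x \<otimes>\<^bsub>G\<^esub> y \<otimes>\<^bsub>G\<^esub> inv\<^bsub>G\<^esub> (R x)))"

definition rota_baxter_group :: "('a, 'm) monoid_scheme \<Rightarrow> ('a \<Rightarrow> 'a) \<Rightarrow> bool" where
  "rota_baxter_group G R \<longleftrightarrow> group G \<and> rota_baxter_operator G R"

definition rota_baxter_hom ::
    "('a, 'm) monoid_scheme \<Rightarrow> ('a \<Rightarrow> 'a) \<Rightarrow> ('b, 'n) monoid_scheme \<Rightarrow> ('b \<Rightarrow> 'b) \<Rightarrow> ('a \<Rightarrow> 'b) set" where
  "rota_baxter_hom G R H S = {f \<in> hom G H. \<forall>x\<in>carrier G. f (R x) = S (f x)}"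

definition rota_baxter_extension ::
    "('a, 'k) monoid_scheme \<Rightarrow> ('a \<Rightarrow> 'a) \<Rightarrow> ('b, 'm) monoid_scheme \<Rightarrow> ('b \<Rightarrow> 'b) \<Rightarrow>
     ('c, 'n) monoid_scheme \<Rightarrow> ('c \<Rightarrow> 'c) \<Rightarrow> ('a \<Rightarrow> 'b) \<Rightarrow> ('b \<Rightarrow> 'c) \<Rightarrow> bool" where
  "rota_baxter_extension I R\<^sub>I E R\<^sub>E H R\<^sub>H i p \<longleftrightarrow>
     rota_baxter_group I R\<^sub>I \<and> rota_baxter_group E R\<^sub>E \<and> rota_baxter_group H R\<^sub>H \<and>
     i \<in> rota_baxter_hom I R\<^sub>I E R\<^sub>E \<and> p \<in> rota_baxter_hom E R\<^sub>E H R\<^sub>H \<and>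
     inj_on i (carrier I) \<and> p ` carrier E = carrier H \<and>
     i ` carrier I = kernel E H p"

definition rota_baxter_brace :: "('a, 'm) monoid_scheme \<Rightarrow> ('a \<Rightarrow> 'a) \<Rightarrow> 'a ring" where
  "rota_baxter_brace G R =
     \<lparr>carrier = carrier G,
      mult = (\<lambda>x y. x \<otimes>\<^bsub>G\<^esub> R x \<otimes>\<^bsub>G\<^esub> y \<otimes>\<^bsub>G\<^esub> inv\<^bsub>G\<^esub> (R x)),
      one = \<one>\<^bsub>G\<^esub>, zero = \<one>\<^bsub>G\<^esub>, add = (\<otimes>\<^bsub>G\<^esub>)\<rparr>"

end

theory Submission
  imports Defs
begin

text \<open>
  For $a$ in a skew left brace, $\lambda_a(b) = -a + a \circ b$ is an automorphism of the additive
  group; if that group is complete, $\lambda_a$ is conjugation by a unique element $R(a)$, and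
  $\lambda_{a \circ b} = \lambda_a \lambda_b$ says that $R$ is a Rota-Baxter operator inducing the
  brace. Uniqueness makes $R$ commute with surjective brace morphisms. For the injection $i$ of the
  extension, uniqueness applies once $R_E(i(a))$ is known to lie in the image of $i$, which holds
  because $p(R_E(i(a))) = R_H(p(i(a))) = R_H(0) = 0$.
\<close>

section \<open>Conjugation in groups with trivial center and in complete groups\<close>

text \<open>If \<open>g\<close> and \<open>h\<close> conjugate alike, then
  \<open>inv h \<otimes> g\<close> commutes with every element, so it lies in the trivial center.
  Every later appeal to uniqueness of a conjugating element is an instance of this.\<close>

lemma (in group) conj_eq_imp_eq:
  assumes "group_center G = {\<one>}" "g \<in> carrier G" "h \<in> carrier G"
    and conj: "\<And>x. x \<in> carrier G \<Longrightarrow> g \<otimes> x \<otimes> inv g = h \<otimes> x \<otimes> inv h"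
  shows "g = h"
proof -
  have "inv h \<otimes> g \<otimes> x = x \<otimes> (inv h \<otimes> g)" if x: "x \<in> carrier G" for x
  proof -
    have "g \<otimes> x = g \<otimes> x \<otimes> inv g \<otimes> g"
      using assms(2) x by (simp add: m_assoc)
    also have "\<dots> = h \<otimes> x \<otimes> inv h \<otimes> g"
      by (simp add: conj x)
    finally have "g \<otimes> x = h \<otimes> (x \<otimes> (inv h \<otimes> g))"
      using assms(2,3) x by (simp add: m_assoc)
    then show ?thesis
      using assms(2,3) x by (simp add: m_assoc inv_solve_left')
  qed
  then have "inv h \<otimes> g \<in> group_center G"
    using assms(2,3) by (simp add: group_center_def)
  then have "inv h \<otimes> g = \<one>"
    using assms(1) by simp
  then show ?thesis
    using assms(2,3) by (metis inv_equality inv_inv inv_closed)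
qed

text \<open>The members of \<open>auto G\<close> are extensional on the carrier, so completeness is
  applied to the restriction of \<open>f\<close>; being inner depends only on the values on the
  carrier.\<close>

lemma complete_group_bij_hom_inner:
  assumes "complete_group G" "f \<in> hom G G" "bij_betw f (carrier G) (carrier G)"
  shows "inner_automorphism G f"
proof -
  interpret group G
    using assms(1) by (simp add: complete_group_def)
  have "restrict f (carrier G) \<in> auto G"
    using assms(2,3) by (auto simp: auto_def Bij_def hom_def Pi_def bij_betw_restrict_eq)
  then have "inner_automorphism G (restrict f (carrier G))"
    using assms(1) by (simp add: complete_group_def)
  then show ?thesis
    by (simp add: inner_automorphism_def)
qed

section \<open>Transfer along equality of brace structures\<close>

lemma group_cong:
  assumes "group G" "carrier F = carrier G" "\<one>\<^bsub>F\<^esub> = \<one>\<^bsub>G\<^esub>"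
    and "\<And>x y. x \<in> carrier G \<Longrightarrow> y \<in> carrier G \<Longrightarrow> x \<otimes>\<^bsub>F\<^esub> y = x \<otimes>\<^bsub>G\<^esub> y"
  shows "group F"
proof -
  interpret group G by fact
  show ?thesis
    by (rule groupI) (auto simp: assms(2-4) m_assoc intro: l_inv_ex)
qed

lemma skew_brace_eq_minus:
  assumes "skew_brace_eq F E" "x \<in> carrier E" "y \<in> carrier E" "group (add_monoid E)"
  shows "x \<ominus>\<^bsub>F\<^esub> y = x \<ominus>\<^bsub>E\<^esub> y"
proof -
  have "\<ominus>\<^bsub>F\<^esub> y = \<ominus>\<^bsub>E\<^esub> y"
    \<comment> \<open>The inverse is a definite description ranging over the carrier, so agreement
      of the operations there makes the two described predicates equal.\<close>
    unfolding a_inv_def m_inv_def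
    using assms(1,3) by (intro arg_cong[where f = The]) (auto simp: skew_brace_eq_def)
  moreover have "\<ominus>\<^bsub>E\<^esub> y \<in> carrier E"
    using group.inv_closed[OF assms(4)] assms(3) by (simp add: a_inv_def)
  ultimately show ?thesis
    using assms(1,2) by (auto simp: skew_brace_eq_def a_minus_def)
qed

lemma skew_left_brace_cong:
  assumes E: "skew_left_brace E" and eq: "skew_brace_eq F E"
  shows "skew_left_brace F"
proof -
  have gp: "group (add_monoid E)" "group E"
    using E by (auto simp: skew_left_brace_def)
  interpret A: group "add_monoid E" by (fact gp)
  interpret M: group E by (fact gp)
  note c = eq[unfolded skew_brace_eq_def]
  have "group (add_monoid F)"
    by (rule group_cong[OF gp(1)]) (use c in auto)
  moreover have "group F"
    by (rule group_cong[OF gp(2)]) (use c in auto)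
  moreover have "a \<otimes>\<^bsub>F\<^esub> (b \<oplus>\<^bsub>F\<^esub> d) = (a \<otimes>\<^bsub>F\<^esub> b \<ominus>\<^bsub>F\<^esub> a) \<oplus>\<^bsub>F\<^esub> (a \<otimes>\<^bsub>F\<^esub> d)"
    if "a \<in> carrier F" "b \<in> carrier F" "d \<in> carrier F" for a b d
  proof -
    have mem: "a \<in> carrier E" "b \<in> carrier E" "d \<in> carrier E"
      using that c by auto
    \<comment> \<open>The operations are known to agree only on the carrier, so the intermediate
      terms have to be placed there before they can be rewritten.\<close>
    have cl: "b \<oplus>\<^bsub>E\<^esub> d \<in> carrier E" "a \<otimes>\<^bsub>E\<^esub> b \<ominus>\<^bsub>E\<^esub> a \<in> carrier E"
      using mem A.m_closed A.inv_closed by (auto simp: a_minus_def a_inv_def)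
    show ?thesis
      using E mem cl c by (simp add: skew_left_brace_def skew_brace_eq_minus[OF eq _ _ gp(1)])
  qed
  ultimately show ?thesis
    by (simp add: skew_left_brace_def)
qed

lemma skew_brace_hom_cong:
  assumes "skew_brace_eq E' E" "skew_brace_eq F' F" "f \<in> skew_brace_hom E F"
  shows "f \<in> skew_brace_hom E' F'"
  using assms by (auto simp: skew_brace_hom_def hom_def skew_brace_eq_def Pi_iff)

lemma skew_brace_extension_cong:
  assumes ext: "skew_brace_extension I E H i p"
    and eqs: "skew_brace_eq I' I" "skew_brace_eq E' E" "skew_brace_eq H' H"
  shows "skew_brace_extension I' E' H' i p"
proof -
  have "a_kernel E' H' p = a_kernel E H p"
    using eqs by (simp add: a_kernel_def kernel_def skew_brace_eq_def)
  then show ?thesis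
    using ext eqs skew_left_brace_cong skew_brace_hom_cong
    unfolding skew_brace_extension_def by (metis skew_brace_eq_def)
qed

section \<open>The operator of a brace with complete additive group\<close>

lemma skew_left_brace_one_eq_zero:
  assumes "skew_left_brace E"
  shows "\<one>\<^bsub>E\<^esub> = \<zero>\<^bsub>E\<^esub>"
proof -
  interpret A: group "add_monoid E"
    rewrites "carrier (add_monoid E) = carrier E" and "mult (add_monoid E) = add E"
      and "one (add_monoid E) = zero E" and "m_inv (add_monoid E) = a_inv E"
    using assms by (auto simp: skew_left_brace_def a_inv_def)
  interpret M: group E
    using assms by (simp add: skew_left_brace_def)
  have "\<one>\<^bsub>E\<^esub> \<otimes>\<^bsub>E\<^esub> (\<zero>\<^bsub>E\<^esub> \<oplus>\<^bsub>E\<^esub> \<zero>\<^bsub>E\<^esub>) =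
      (\<one>\<^bsub>E\<^esub> \<otimes>\<^bsub>E\<^esub> \<zero>\<^bsub>E\<^esub> \<ominus>\<^bsub>E\<^esub> \<one>\<^bsub>E\<^esub>) \<oplus>\<^bsub>E\<^esub> (\<one>\<^bsub>E\<^esub> \<otimes>\<^bsub>E\<^esub> \<zero>\<^bsub>E\<^esub>)"
    using assms A.one_closed M.one_closed unfolding skew_left_brace_def by blast
  then have "\<zero>\<^bsub>E\<^esub> = \<ominus>\<^bsub>E\<^esub> \<one>\<^bsub>E\<^esub>"
    by (simp add: a_minus_def)
  then show ?thesis
    by (metis A.inv_inv A.inv_one M.one_closed)
qed

lemma complete_skew_left_brace_rota_baxter:
  assumes E: "skew_left_brace E" and complete: "complete_group (add_monoid E)"
  obtains R where "rota_baxter_operator (add_monoid E) R"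
    "skew_brace_eq (rota_baxter_brace (add_monoid E) R) E"
proof -
  interpret A: group "add_monoid E"
    rewrites "carrier (add_monoid E) = carrier E" and "mult (add_monoid E) = add E"
      and "one (add_monoid E) = zero E" and "m_inv (add_monoid E) = a_inv E"
    using E by (auto simp: skew_left_brace_def a_inv_def)
  interpret M: group E
    using E by (simp add: skew_left_brace_def)
  have distrib: "a \<otimes>\<^bsub>E\<^esub> (b \<oplus>\<^bsub>E\<^esub> c) = a \<otimes>\<^bsub>E\<^esub> b \<oplus>\<^bsub>E\<^esub> (\<ominus>\<^bsub>E\<^esub> a \<oplus>\<^bsub>E\<^esub> a \<otimes>\<^bsub>E\<^esub> c)"
    if "a \<in> carrier E" "b \<in> carrier E" "c \<in> carrier E" for a b c
    using E that by (simp add: skew_left_brace_def a_minus_def A.m_assoc)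
  define lam where "lam a b = \<ominus>\<^bsub>E\<^esub> a \<oplus>\<^bsub>E\<^esub> a \<otimes>\<^bsub>E\<^esub> b" for a b
  have circ: "a \<otimes>\<^bsub>E\<^esub> b = a \<oplus>\<^bsub>E\<^esub> lam a b" if "a \<in> carrier E" "b \<in> carrier E" for a b
    using that by (simp add: lam_def A.m_assoc[symmetric])
  have lam_closed: "lam a b \<in> carrier E" if "a \<in> carrier E" "b \<in> carrier E" for a b
    using that by (simp add: lam_def)
  have lam_add: "lam a (b \<oplus>\<^bsub>E\<^esub> c) = lam a b \<oplus>\<^bsub>E\<^esub> lam a c"
    if "a \<in> carrier E" "b \<in> carrier E" "c \<in> carrier E" for a b c
    using that by (simp add: lam_def distrib A.m_assoc)
  have lam_circ: "lam (a \<otimes>\<^bsub>E\<^esub> b) c = lam a (lam b c)"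
    if mem: "a \<in> carrier E" "b \<in> carrier E" "c \<in> carrier E" for a b c
  proof -
    have "a \<otimes>\<^bsub>E\<^esub> b \<oplus>\<^bsub>E\<^esub> lam (a \<otimes>\<^bsub>E\<^esub> b) c = a \<otimes>\<^bsub>E\<^esub> (b \<otimes>\<^bsub>E\<^esub> c)"
      using mem by (simp add: circ[symmetric] M.m_assoc)
    also have "\<dots> = a \<otimes>\<^bsub>E\<^esub> b \<oplus>\<^bsub>E\<^esub> lam a (lam b c)"
      using mem by (simp add: circ[of b c] distrib lam_closed) (simp add: lam_def)
    finally show ?thesis
      by (metis A.Units_eq A.Units_l_cancel M.m_closed lam_closed mem)
  qed
  have lam_bij: "bij_betw (lam a) (carrier E) (carrier E)" if a: "a \<in> carrier E" for a
  proof (rule bij_betwI[where g = "\<lambda>b. inv\<^bsub>E\<^esub> a \<otimes>\<^bsub>E\<^esub> (a \<oplus>\<^bsub>E\<^esub> b)"])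
    show "inv\<^bsub>E\<^esub> a \<otimes>\<^bsub>E\<^esub> (a \<oplus>\<^bsub>E\<^esub> lam a b) = b" if "b \<in> carrier E" for b
      using a that by (simp add: circ[symmetric] M.m_assoc[symmetric])
    show "lam a (inv\<^bsub>E\<^esub> a \<otimes>\<^bsub>E\<^esub> (a \<oplus>\<^bsub>E\<^esub> b)) = b" if "b \<in> carrier E" for b
      using a that by (simp add: lam_def M.m_assoc[symmetric] A.m_assoc[symmetric])
  qed (use a lam_closed in auto)
  have "\<exists>g\<in>carrier E. \<forall>b\<in>carrier E. lam a b = g \<oplus>\<^bsub>E\<^esub> b \<oplus>\<^bsub>E\<^esub> \<ominus>\<^bsub>E\<^esub> g" if a: "a \<in> carrier E" for a
  proof -
    have "inner_automorphism (add_monoid E) (lam a)"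
      by (rule complete_group_bij_hom_inner[OF complete])
        (use a lam_add lam_closed lam_bij in \<open>auto simp: hom_def\<close>)
    then show ?thesis
      by (simp add: inner_automorphism_def a_inv_def)
  qed
  then obtain R where R_closed: "\<And>a. a \<in> carrier E \<Longrightarrow> R a \<in> carrier E"
    and lam_R: "\<And>a b. a \<in> carrier E \<Longrightarrow> b \<in> carrier E \<Longrightarrow> lam a b = R a \<oplus>\<^bsub>E\<^esub> b \<oplus>\<^bsub>E\<^esub> \<ominus>\<^bsub>E\<^esub> R a"
    by metis
  have circ_R: "a \<oplus>\<^bsub>E\<^esub> R a \<oplus>\<^bsub>E\<^esub> b \<oplus>\<^bsub>E\<^esub> \<ominus>\<^bsub>E\<^esub> R a = a \<otimes>\<^bsub>E\<^esub> b" if "a \<in> carrier E" "b \<in> carrier E" for a b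
    using that by (simp add: circ lam_R R_closed A.m_assoc)
  have center: "group_center (add_monoid E) = {\<zero>\<^bsub>E\<^esub>}"
    using complete by (simp add: complete_group_def)
  have R_circ: "R a \<oplus>\<^bsub>E\<^esub> R b = R (a \<otimes>\<^bsub>E\<^esub> b)" if mem: "a \<in> carrier E" "b \<in> carrier E" for a b
  \<comment> \<open>Conjugation by either side is the automorphism
    \<open>lam (a \<otimes> b)\<close>, computed directly or as a composite.\<close>
  proof (rule A.conj_eq_imp_eq[OF center])
    fix x assume x: "x \<in> carrier E"
    have "R (a \<otimes>\<^bsub>E\<^esub> b) \<oplus>\<^bsub>E\<^esub> x \<oplus>\<^bsub>E\<^esub> \<ominus>\<^bsub>E\<^esub> R (a \<otimes>\<^bsub>E\<^esub> b) = lam a (lam b x)"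
      using mem x by (simp add: lam_R[symmetric] lam_circ)
    also have "\<dots> = R a \<oplus>\<^bsub>E\<^esub> R b \<oplus>\<^bsub>E\<^esub> x \<oplus>\<^bsub>E\<^esub> \<ominus>\<^bsub>E\<^esub> (R a \<oplus>\<^bsub>E\<^esub> R b)"
      using mem x by (simp add: lam_R R_closed A.m_assoc A.inv_mult_group)
    finally show "R a \<oplus>\<^bsub>E\<^esub> R b \<oplus>\<^bsub>E\<^esub> x \<oplus>\<^bsub>E\<^esub> \<ominus>\<^bsub>E\<^esub> (R a \<oplus>\<^bsub>E\<^esub> R b) =
        R (a \<otimes>\<^bsub>E\<^esub> b) \<oplus>\<^bsub>E\<^esub> x \<oplus>\<^bsub>E\<^esub> \<ominus>\<^bsub>E\<^esub> R (a \<otimes>\<^bsub>E\<^esub> b)"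
      by simp
  qed (use mem R_closed in auto)
  show ?thesis
  proof
    show "rota_baxter_operator (add_monoid E) R"
      using R_closed circ_R R_circ by (simp add: rota_baxter_operator_def a_inv_def)
    show "skew_brace_eq (rota_baxter_brace (add_monoid E) R) E"
      using skew_left_brace_one_eq_zero[OF E] circ_R
      by (simp add: skew_brace_eq_def rota_baxter_brace_def a_inv_def)
  qed
qed

section \<open>Brace morphisms as Rota-Baxter morphisms\<close>

text \<open>Expand \<open>f\<close> of the circle product of \<open>x\<close> and \<open>y\<close>
  in both braces and cancel \<open>f x\<close>. The two conjugations are compared only on the image
  of \<open>f\<close>, which is why the surjective and injective cases are treated
  separately.\<close>

lemma rota_baxter_brace_hom_conj:
  assumes "rota_baxter_group G R" "rota_baxter_group H S"
    and f: "f \<in> skew_brace_hom (rota_baxter_brace G R) (rota_baxter_brace H S)"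
    and mem: "x \<in> carrier G" "y \<in> carrier G"
  shows "f (R x) \<otimes>\<^bsub>H\<^esub> f y \<otimes>\<^bsub>H\<^esub> inv\<^bsub>H\<^esub> f (R x) = S (f x) \<otimes>\<^bsub>H\<^esub> f y \<otimes>\<^bsub>H\<^esub> inv\<^bsub>H\<^esub> S (f x)"
proof -
  interpret G: group G
    using assms(1) by (simp add: rota_baxter_group_def)
  interpret H: group H
    using assms(2) by (simp add: rota_baxter_group_def)
  have "f \<in> hom G H"
    using f by (simp add: skew_brace_hom_def rota_baxter_brace_def hom_def)
  then interpret group_hom G H f
    by unfold_locales
  have R: "R x \<in> carrier G" and S: "S (f x) \<in> carrier H"
    using assms(1,2) mem by (auto simp: rota_baxter_group_def rota_baxter_operator_def)
  have "f (x \<otimes>\<^bsub>G\<^esub> R x \<otimes>\<^bsub>G\<^esub> y \<otimes>\<^bsub>G\<^esub> inv\<^bsub>G\<^esub> R x) = f x \<otimes>\<^bsub>H\<^esub> S (f x) \<otimes>\<^bsub>H\<^esub> f y \<otimes>\<^bsub>H\<^esub> inv\<^bsub>H\<^esub> S (f x)"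
    using f mem by (simp add: skew_brace_hom_def rota_baxter_brace_def hom_def)
  then show ?thesis
    using mem R S by (simp add: H.m_assoc)
qed

text \<open>Surjectivity turns agreement of the conjugations on the image into agreement on all of
  \<open>H\<close>, where the trivial center applies.\<close>

lemma rota_baxter_brace_hom_surj:
  assumes "rota_baxter_group G R" and H: "rota_baxter_group H S"
    and f: "f \<in> skew_brace_hom (rota_baxter_brace G R) (rota_baxter_brace H S)"
    and "group_center H = {\<one>\<^bsub>H\<^esub>}" and surj: "f ` carrier G = carrier H"
  shows "f \<in> rota_baxter_hom G R H S"
proof -
  interpret H: group H
    using H by (simp add: rota_baxter_group_def)
  have hom: "f \<in> hom G H"
    using f by (simp add: skew_brace_hom_def rota_baxter_brace_def hom_def)
  have "f (R x) = S (f x)" if x: "x \<in> carrier G" for x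
  proof (rule H.conj_eq_imp_eq)
    show "f (R x) \<in> carrier H" "S (f x) \<in> carrier H"
      using assms(1,2) hom x
      by (auto simp: rota_baxter_group_def rota_baxter_operator_def hom_def Pi_iff)
  next
    fix z assume "z \<in> carrier H"
    then obtain y where "y \<in> carrier G" "z = f y"
      using surj by blast
    then show "f (R x) \<otimes>\<^bsub>H\<^esub> z \<otimes>\<^bsub>H\<^esub> inv\<^bsub>H\<^esub> f (R x) = S (f x) \<otimes>\<^bsub>H\<^esub> z \<otimes>\<^bsub>H\<^esub> inv\<^bsub>H\<^esub> S (f x)"
      using rota_baxter_brace_hom_conj[OF assms(1,2) f x] by simp
  qed fact
  then show ?thesis
    using hom by (simp add: rota_baxter_hom_def)
qed

text \<open>The comparison is pulled back to \<open>G\<close>: write \<open>S (f x)\<close> as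
  \<open>f c\<close>, so that \<open>R x\<close> and \<open>c\<close> conjugate alike in
  \<open>G\<close> by injectivity and are equal since the center of \<open>G\<close> is
  trivial.\<close>

lemma rota_baxter_brace_hom_inj:
  assumes G: "rota_baxter_group G R" and H: "rota_baxter_group H S"
    and f: "f \<in> skew_brace_hom (rota_baxter_brace G R) (rota_baxter_brace H S)"
    and "group_center G = {\<one>\<^bsub>G\<^esub>}" and inj: "inj_on f (carrier G)"
    and image: "\<And>x. x \<in> carrier G \<Longrightarrow> S (f x) \<in> f ` carrier G"
  shows "f \<in> rota_baxter_hom G R H S"
proof -
  interpret G: group G
    using G by (simp add: rota_baxter_group_def)
  interpret H: group H
    using H by (simp add: rota_baxter_group_def)
  have hom: "f \<in> hom G H"
    using f by (simp add: skew_brace_hom_def rota_baxter_brace_def hom_def)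
  then interpret group_hom G H f
    by unfold_locales
  have "f (R x) = S (f x)" if x: "x \<in> carrier G" for x
  proof -
    obtain c where c: "c \<in> carrier G" "S (f x) = f c"
      using image[OF x] by auto
    have R: "R x \<in> carrier G"
      using G x by (auto simp: rota_baxter_group_def rota_baxter_operator_def)
    have "R x = c"
    proof (rule G.conj_eq_imp_eq)
      fix y assume y: "y \<in> carrier G"
      have "f (R x \<otimes>\<^bsub>G\<^esub> y \<otimes>\<^bsub>G\<^esub> inv\<^bsub>G\<^esub> R x) = f (c \<otimes>\<^bsub>G\<^esub> y \<otimes>\<^bsub>G\<^esub> inv\<^bsub>G\<^esub> c)"
        using rota_baxter_brace_hom_conj[OF G H f x y] R c y by simp
      then show "R x \<otimes>\<^bsub>G\<^esub> y \<otimes>\<^bsub>G\<^esub> inv\<^bsub>G\<^esub> R x = c \<otimes>\<^bsub>G\<^esub> y \<otimes>\<^bsub>G\<^esub> inv\<^bsub>G\<^esub> c"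
        using R c y by (intro inj_onD[OF inj]) auto
    qed fact+
    then show ?thesis
      using c by simp
  qed
  then show ?thesis
    using hom by (simp add: rota_baxter_hom_def)
qed

text \<open>The Rota-Baxter identity at $x = y = 1$ makes the value idempotent, and the only
  idempotent of a group is its identity.\<close>

lemma rota_baxter_operator_one:
  assumes "rota_baxter_group G R"
  shows "R \<one>\<^bsub>G\<^esub> = \<one>\<^bsub>G\<^esub>"
proof -
  interpret group G
    using assms by (simp add: rota_baxter_group_def)
  have R: "R \<one>\<^bsub>G\<^esub> \<in> carrier G"
    and "R \<one>\<^bsub>G\<^esub> \<otimes>\<^bsub>G\<^esub> R \<one>\<^bsub>G\<^esub> = R (\<one>\<^bsub>G\<^esub> \<otimes>\<^bsub>G\<^esub> R \<one>\<^bsub>G\<^esub> \<otimes>\<^bsub>G\<^esub> \<one>\<^bsub>G\<^esub> \<otimes>\<^bsub>G\<^esub> inv\<^bsub>G\<^esub> (R \<one>\<^bsub>G\<^esub>))"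
    using assms by (auto simp: rota_baxter_group_def rota_baxter_operator_def)
  then have "R \<one>\<^bsub>G\<^esub> \<otimes>\<^bsub>G\<^esub> R \<one>\<^bsub>G\<^esub> = R \<one>\<^bsub>G\<^esub>"
    by simp
  then show ?thesis
    using R by simp
qed

text \<open>The map \<open>p\<close> is treated first, by surjectivity; its compatibility with the
  operators, together with exactness, then supplies the image condition needed for
  \<open>i\<close>.\<close>

lemma skew_brace_extension_rota_baxter:
  assumes I: "rota_baxter_group I R\<^sub>I" and E: "rota_baxter_group E R\<^sub>E" and H: "rota_baxter_group H R\<^sub>H"
    and ext: "skew_brace_extension (rota_baxter_brace I R\<^sub>I) (rota_baxter_brace E R\<^sub>E)
      (rota_baxter_brace H R\<^sub>H) i p"
    and center: "group_center I = {\<one>\<^bsub>I\<^esub>}" "group_center H = {\<one>\<^bsub>H\<^esub>}"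
  shows "rota_baxter_extension I R\<^sub>I E R\<^sub>E H R\<^sub>H i p"
proof -
  have inj: "inj_on i (carrier I)" and surj: "p ` carrier E = carrier H"
    and exact: "i ` carrier I = kernel E H p"
    and i: "i \<in> skew_brace_hom (rota_baxter_brace I R\<^sub>I) (rota_baxter_brace E R\<^sub>E)"
    and p: "p \<in> skew_brace_hom (rota_baxter_brace E R\<^sub>E) (rota_baxter_brace H R\<^sub>H)"
    \<comment> \<open>The zero of an induced brace is the group identity, so the additive kernel of
      \<open>p\<close> is its kernel as a group homomorphism.\<close>
    using ext
    by (simp_all add: skew_brace_extension_def a_kernel_def kernel_def)
      (simp_all add: rota_baxter_brace_def)
  have p_hom: "p \<in> rota_baxter_hom E R\<^sub>E H R\<^sub>H"
    by (rule rota_baxter_brace_hom_surj[OF E H p center(2) surj])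
  have "R\<^sub>E (i x) \<in> i ` carrier I" if x: "x \<in> carrier I" for x
  proof -
    have ker: "i x \<in> carrier E" "p (i x) = \<one>\<^bsub>H\<^esub>"
      using exact x by (auto simp: kernel_def)
    then have "p (R\<^sub>E (i x)) = \<one>\<^bsub>H\<^esub>"
      using p_hom rota_baxter_operator_one[OF H] by (simp add: rota_baxter_hom_def)
    moreover have "R\<^sub>E (i x) \<in> carrier E"
      using E ker by (auto simp: rota_baxter_group_def rota_baxter_operator_def)
    ultimately show ?thesis
      by (simp add: exact kernel_def)
  qed
  then have "i \<in> rota_baxter_hom I R\<^sub>I E R\<^sub>E"
    by (rule rota_baxter_brace_hom_inj[OF I E i center(1) inj])
  then show ?thesis
    using I E H p_hom inj surj exact by (simp add: rota_baxter_extension_def)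
qed

theorem theorem6p4:
  fixes I :: "'a ring" and E :: "'b ring" and H :: "'c ring"
    and i :: "'a \<Rightarrow> 'b" and p :: "'b \<Rightarrow> 'c"
  assumes "skew_brace_extension I E H i p"
    and "complete_group (add_monoid I)"
    and "complete_group (add_monoid E)"
    and "complete_group (add_monoid H)"
  shows "\<exists>R\<^sub>I R\<^sub>E R\<^sub>H.
     rota_baxter_extension (add_monoid I) R\<^sub>I (add_monoid E) R\<^sub>E (add_monoid H) R\<^sub>H i p \<and>
     skew_brace_extension (rota_baxter_brace (add_monoid I) R\<^sub>I)
       (rota_baxter_brace (add_monoid E) R\<^sub>E) (rota_baxter_brace (add_monoid H) R\<^sub>H) i p \<and>
     skew_brace_eq (rota_baxter_brace (add_monoid I) R\<^sub>I) I \<and>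
     skew_brace_eq (rota_baxter_brace (add_monoid E) R\<^sub>E) E \<and>
     skew_brace_eq (rota_baxter_brace (add_monoid H) R\<^sub>H) H"
proof -
  have braces: "skew_left_brace I" "skew_left_brace E" "skew_left_brace H"
    using assms(1) by (auto simp: skew_brace_extension_def)
  obtain R\<^sub>I where I: "rota_baxter_operator (add_monoid I) R\<^sub>I"
    "skew_brace_eq (rota_baxter_brace (add_monoid I) R\<^sub>I) I"
    using complete_skew_left_brace_rota_baxter[OF braces(1) assms(2)] .
  obtain R\<^sub>E where E: "rota_baxter_operator (add_monoid E) R\<^sub>E"
    "skew_brace_eq (rota_baxter_brace (add_monoid E) R\<^sub>E) E"
    using complete_skew_left_brace_rota_baxter[OF braces(2) assms(3)] .
  obtain R\<^sub>H where H: "rota_baxter_operator (add_monoid H) R\<^sub>H"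
    "skew_brace_eq (rota_baxter_brace (add_monoid H) R\<^sub>H) H"
    using complete_skew_left_brace_rota_baxter[OF braces(3) assms(4)] .
  \<comment> \<open>The given extension is restated for the induced braces, so that \<open>i\<close>
    and \<open>p\<close> become morphisms between them and the operators can be compared.\<close>
  have ext: "skew_brace_extension (rota_baxter_brace (add_monoid I) R\<^sub>I)
      (rota_baxter_brace (add_monoid E) R\<^sub>E) (rota_baxter_brace (add_monoid H) R\<^sub>H) i p"
    by (rule skew_brace_extension_cong[OF assms(1) I(2) E(2) H(2)])
  moreover have "rota_baxter_extension (add_monoid I) R\<^sub>I (add_monoid E) R\<^sub>E (add_monoid H) R\<^sub>H i p"
    using assms(2-4) I(1) E(1) H(1)
    by (intro skew_brace_extension_rota_baxter[OF _ _ _ ext])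
      (simp_all add: rota_baxter_group_def complete_group_def)
  ultimately show ?thesis
    using I(2) E(2) H(2) by blast
qed

end
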